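(* Let $E$ be a $c_{00}$-dense standard Banach sequence space. Then the set \[ \mathcal{S}=\{T\colon E\to E : T \text{ is linear, continuous and surjective}\} \] is spaceable in $\mathcal{L}(E;E)$.
   Context: All vector spaces are over a fixed scalar field $\mathbb{K}$, which is either $\mathbb{R}$ or $\mathbb{C}$. For Banach spaces $V,E$, $\mathcal{L}(V;E)$ is the Banach space of all continuous linear operators $V\to E$ with the operator norm. Spaceable: a subset $A$ of a topological vector space $V$ is spaceable in $V$ if $A\cup\{0\}$ contains a closed infinite-dimensional linear subspace of $V$. Standard Banach sequence space: let $X\neq\{0\}$ be a Banach space over $\mathbb{K}$. A standard Banach sequence space over $X$ is an infinite-dimensional Banach space $E$ whose elements are $X$-valued sequences $x=(x_j)_{j=1}^\infty$ (with coordinatewise linear operations) such that: (i) there is $C>0$ such that $\|x_j\|_X\le C\|x\|_E$ for every $x=(x_j)_{j=1}^\infty\in E$ and all $j\in\mathbb{N}$; (ii) if $x=(x_j)_{j=1}^\infty\in E$ and $(x_{n_k})_{k=1}^\infty$ is a subsequence of $x$, then $(x_{n_k})_{k=1}^\infty\in E$ and $\|(x_{n_k})_{k=1}^\infty\|_E\le\|x\|_E$; (iii) if $(x_j)_{j=1}^\infty\in E$ and $\{n_1<n_2<n_3<\cdots\}$ is an infinite subset of $\mathbb{N}$, then the sequence $(y_j)_{j=1}^\infty$ defined by $y_j=x_i$ if $j=n_i$, and $y_j=0$ otherwise, belongs to $E$ and $\|(y_j)_{j=1}^\infty\|_E\le\|(x_j)_{j=1}^\infty\|_E$. A standard Banach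 sequence space is a standard Banach sequence space over some Banach space $X\ne\{0\}$. It is called $c_{00}$-dense if $c_{00}(X)$, the space of $X$-valued sequences with only finitely many nonzero terms, is (contained in and) dense in $E$. *)

theory Defs
  imports "HOL-Analysis.Analysis"
begin

text \<open>
  The scalar field: up to isometric isomorphism the two instances below are the only ones,
  since a multiplicative norm extending the absolute value of the reals is unique on the
  complex numbers.
\<close>

class real_or_complex = real_normed_field +
  assumes real_or_complex:
    "(\<forall>z. \<exists>a. z = a *\<^sub>R 1) \<or>
     (\<exists>i. i * i = - 1 \<and> (\<forall>z. \<exists>a b. z = a *\<^sub>R 1 + b *\<^sub>R i))"

instance real :: real_or_complex
  by standard auto

instance complex :: real_or_complex
proof
  have "z = Re z *\<^sub>R 1 + Im z *\<^sub>R \<i>" for z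
    by (simp add: complex_eq_iff)
  then have "\<i> * \<i> = - 1 \<and> (\<forall>z. \<exists>a b. z = a *\<^sub>R 1 + b *\<^sub>R \<i>)"
    by (metis i_squared)
  then show "(\<forall>z::complex. \<exists>a. z = a *\<^sub>R 1) \<or>
      (\<exists>i::complex. i * i = - 1 \<and> (\<forall>z. \<exists>a b. z = a *\<^sub>R 1 + b *\<^sub>R i))"
    by blast
qed

text \<open>
  A Banach space over the scalar field \<open>'k\<close>: the additive group, norm and completeness come from
  the class \<^class>\<open>banach\<close>, the scalar multiplication is a parameter extending \<^const>\<open>scaleR\<close>.
\<close>

locale banach_space_over = vector_space scale
  for scale :: "'k::real_or_complex \<Rightarrow> 'v::banach \<Rightarrow> 'v" +
  assumes norm_scale: "norm (scale c x) = norm c * norm x"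
    and scale_of_real: "scale (of_real r) x = r *\<^sub>R x"

lemma banach_space_over_scaleR: "banach_space_over (scaleR :: real \<Rightarrow> 'v::banach \<Rightarrow> 'v)"
  by unfold_locales (auto simp: algebra_simps)

lemma banach_space_over_mult: "banach_space_over ((*) :: complex \<Rightarrow> complex \<Rightarrow> complex)"
  by unfold_locales (auto simp: algebra_simps norm_mult scaleR_conv_of_real)

definition infinite_dimensional ::
    "('k::field \<Rightarrow> 'v::ab_group_add \<Rightarrow> 'v) \<Rightarrow> 'v set \<Rightarrow> bool" where
  "infinite_dimensional smul W \<longleftrightarrow> \<not> (\<exists>B. finite B \<and> module.span smul B = W)"

text \<open>The ambient space is the linear subspace \<open>V\<close>, with the subspace topology.\<close>

definition spaceable_in ::
    "('k::field \<Rightarrow> 'v::{ab_group_add,topological_space} \<Rightarrow> 'v) \<Rightarrow> 'v set \<Rightarrow> 'v set \<Rightarrow> bool" where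
  "spaceable_in smul V A \<longleftrightarrow>
     (\<exists>W. module.subspace smul W \<and> closedin (top_of_set V) W \<and>
          infinite_dimensional smul W \<and> W \<subseteq> A \<union> {0})"

text \<open>
  A Banach space \<open>E\<close> of \<open>X\<close>-valued sequences is given by a Banach space type \<open>'e\<close> together with an
  injective map \<open>coord\<close> sending each element to the sequence it stands for; linearity of every
  \<open>\<lambda>x. coord x j\<close> says that the linear operations are coordinatewise. Sequences are indexed
  from 0.
\<close>

locale standard_banach_sequence_space =
  X: banach_space_over scaleX + E: banach_space_over scaleE
  for scaleX :: "'k::real_or_complex \<Rightarrow> 'x::banach \<Rightarrow> 'x"
    and scaleE :: "'k \<Rightarrow> 'e::banach \<Rightarrow> 'e" +
  fixes coord :: "'e \<Rightarrow> nat \<Rightarrow> 'x"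
  assumes X_nonzero: "\<exists>v::'x. v \<noteq> 0"
    and E_infinite_dimensional: "infinite_dimensional scaleE (UNIV :: 'e set)"
    and coord_inj: "inj coord"
    and coord_linear: "Vector_Spaces.linear scaleE scaleX (\<lambda>x. coord x j)"
    and coord_bounded: "\<exists>C>0. \<forall>x j. norm (coord x j) \<le> C * norm x"
    and subsequence: "strict_mono (n :: nat \<Rightarrow> nat) \<Longrightarrow>
      \<exists>y. (\<forall>k. coord y k = coord x (n k)) \<and> norm y \<le> norm x"
    and spread: "strict_mono (n :: nat \<Rightarrow> nat) \<Longrightarrow>
      \<exists>y. (\<forall>i. coord y (n i) = coord x i) \<and> (\<forall>j. j \<notin> range n \<longrightarrow> coord y j = 0) \<and>
          norm y \<le> norm x"

definition c00 :: "(nat \<Rightarrow> 'x::zero) set" where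
  "c00 = {s. finite {j. s j \<noteq> 0}}"

definition c00_dense :: "('e::topological_space \<Rightarrow> nat \<Rightarrow> 'x::zero) \<Rightarrow> bool" where
  "c00_dense coord \<longleftrightarrow> c00 \<subseteq> range coord \<and> closure {x. coord x \<in> c00} = UNIV"

text \<open>
  The type \<open>'e \<Rightarrow>\<^sub>L 'e\<close> consists of the real-linear continuous operators with the operator norm.
  The continuous operators that are linear over the scalar field \<open>'k\<close> form a subspace of it.
\<close>

definition operators ::
    "('k::real_or_complex \<Rightarrow> 'e::banach \<Rightarrow> 'e) \<Rightarrow> ('e \<Rightarrow>\<^sub>L 'e) set" where
  "operators smul = {T. Vector_Spaces.linear smul smul (blinfun_apply T)}"

definition blinfun_scale ::
    "('k::real_or_complex \<Rightarrow> 'e::banach \<Rightarrow> 'e) \<Rightarrow> 'k \<Rightarrow> ('e \<Rightarrow>\<^sub>L 'e) \<Rightarrow> ('e \<Rightarrow>\<^sub>L 'e)" where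
  "blinfun_scale smul c T = Blinfun (\<lambda>x. smul c (blinfun_apply T x))"

context banach_space_over
begin

lemma scale_scaleR: "scale c (r *\<^sub>R x) = r *\<^sub>R scale c x"
  by (metis scale_of_real scale_left_commute)

lemma bounded_linear_scale: "bounded_linear (scale c)"
  by (rule bounded_linear_intro[where K = "norm c"])
    (auto simp: scale_right_distrib scale_scaleR norm_scale)

lemma blinfun_apply_scale [simp]:
  "blinfun_apply (blinfun_scale scale c T) x = scale c (blinfun_apply T x)"
  unfolding blinfun_scale_def
  by (simp add: bounded_linear_Blinfun_apply
      bounded_linear_compose[OF bounded_linear_scale blinfun.bounded_linear_right])

lemma vector_space_blinfun_scale: "vector_space (blinfun_scale scale)"
  by unfold_locales
    (auto intro!: blinfun_eqI simp: blinfun.add_left scale_right_distrib scale_left_distrib)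

lemma subspace_operators: "module.subspace (blinfun_scale scale) (operators scale)"
proof -
  interpret B: vector_space "blinfun_scale scale" by (rule vector_space_blinfun_scale)
  show ?thesis
    unfolding B.subspace_def operators_def
    by (auto simp: Vector_Spaces.linear_iff_module_hom module_hom_iff module_axioms blinfun.add_left scale_right_distrib mult.commute)
qed

end

end

theory Submission
  imports Defs
begin

text \<open>
  Split the index set into infinitely many infinite rows. Write \<open>S\<^sub>i\<close> for the map that spreads a
  sequence onto row \<open>i\<close> and fills up with zeros, and consider the continuous linear operators \<open>T\<close>
  for which every composition \<open>T \<circ> S\<^sub>i\<close> is a scalar multiple \<open>a\<^sub>i\<close> of the identity. They
  form the required subspace.

  \<^item> It is closed, because the multiples of the identity form a closed set of operators; this
    rests on the completeness of the scalar field (\<open>scalars_complete\<close>).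
  \<^item> It is infinite-dimensional: it contains the operator \<open>R\<^sub>i\<close> that restricts a sequence to
    row \<open>i\<close>, for every \<open>i\<close>. As \<open>R\<^sub>i \<circ> S\<^sub>i\<close> is the identity and \<open>R\<^sub>j \<circ> S\<^sub>i = 0\<close> for
    \<open>j \<noteq> i\<close>, these operators are linearly independent.
  \<^item> If some \<open>a\<^sub>i\<close> is nonzero then \<open>T\<close> is surjective, since \<open>T (S\<^sub>i (a\<^sub>i\<inverse> w)) = w\<close>.
  \<^item> If all \<open>a\<^sub>i\<close> vanish then \<open>T\<close> kills every sequence supported in a single row. A finitely
    supported sequence is a finite sum of such sequences, so \<open>T\<close> vanishes on a dense
    subspace and hence \<open>T = 0\<close>. This is where the density of the finitely supported sequences
    enters.

  Describing the subspace by these compositions, instead of as a closure of the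
  span of the \<open>R\<^sub>i\<close>, makes the structure of its elements immediate.
\<close>

section \<open>Completeness of the scalar field\<close>

text \<open>
  In the complex case, \<open>a + b \<i> \<mapsto> a + b i\<close> is a bijective field homomorphism from the
  complex numbers. Its norm has a positive minimum on the compact unit circle, so Cauchy
  sequences of scalars come from Cauchy sequences of complex numbers.
\<close>

lemma scalars_complete:
  fixes X :: "nat \<Rightarrow> 'k::real_or_complex"
  assumes "Cauchy X"
  shows "convergent X"
proof -
  consider (real) "\<forall>z::'k. \<exists>a. z = a *\<^sub>R 1"
    | (complex) i :: 'k where "i * i = - 1" "\<forall>z. \<exists>a b. z = a *\<^sub>R 1 + b *\<^sub>R i"
    using real_or_complex[where 'a = 'k] by blast
  then show ?thesis
  proof cases
    case real
    then have "\<forall>n. \<exists>a. X n = of_real a"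
      by (simp add: of_real_def)
    then obtain a where a: "\<And>n. X n = of_real (a n)"
      by metis
    have "dist (X m) (X n) = dist (a m) (a n)" for m n
      by (simp add: a dist_norm flip: of_real_diff)
    then have "Cauchy a"
      using assms by (simp add: Cauchy_def)
    then obtain l where "a \<longlonglongrightarrow> l"
      by (meson Cauchy_convergent convergent_def)
    then have "(\<lambda>n. of_real (a n)) \<longlonglongrightarrow> (of_real l :: 'k)"
      by (rule tendsto_of_real)
    then show ?thesis
      by (auto simp: convergent_def a[abs_def])
  next
    case complex
    define f :: "complex \<Rightarrow> 'k" where "f z = Re z *\<^sub>R 1 + Im z *\<^sub>R i" for z
    have f_diff: "f (z - w) = f z - f w" for z w
      by (simp add: f_def algebra_simps)
    have f_scaleR: "f (r *\<^sub>R z) = r *\<^sub>R f z" for r z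
      by (simp add: f_def algebra_simps)
    have f_mult: "f (z * w) = f z * f w" for z w
    proof -
      have "f z * f w = (Re z * Re w) *\<^sub>R 1 + (Re z * Im w + Im z * Re w) *\<^sub>R i
          + (Im z * Im w) *\<^sub>R (i * i)"
        by (simp add: f_def algebra_simps)
      then show ?thesis
        by (simp add: f_def complex(1) algebra_simps)
    qed
    have f_nonzero: "f z \<noteq> 0" if "z \<noteq> 0" for z
      using f_mult[of z "inverse z"] that by (auto simp: f_def)
    have f_cont: "continuous_on A f" for A
      unfolding f_def by (intro continuous_intros)
    obtain u where u: "u \<in> sphere 0 1" "\<And>z. z \<in> sphere 0 1 \<Longrightarrow> norm (f u) \<le> norm (f z)"
      using continuous_attains_inf[of "sphere (0::complex) 1" "\<lambda>z. norm (f z)"]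
        continuous_on_norm[OF f_cont] by (auto simp: ex_in_conv[symmetric] intro: exI[of _ 1])
    define m where "m = norm (f u)"
    have m: "m > 0"
      using u(1) f_nonzero[of u] by (cases "u = 0") (auto simp: m_def)
    have below: "m * norm z \<le> norm (f z)" for z
    proof (cases "z = 0")
      case False
      then have "m \<le> norm (f (inverse (norm z) *\<^sub>R z))"
        unfolding m_def by (intro u(2)) simp
      then show ?thesis
        using False by (simp add: f_scaleR field_simps)
    qed simp
    have "\<exists>z. X n = f z" for n
    proof -
      obtain a b where "X n = a *\<^sub>R 1 + b *\<^sub>R i"
        using complex(2) by blast
      then have "X n = f (Complex a b)"
        by (simp add: f_def)
      then show ?thesis ..
    qed
    then obtain z where z: "\<And>n. X n = f (z n)"
      by metis
    have "Cauchy z"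
    proof (rule metric_CauchyI)
      fix e :: real assume "e > 0"
      then obtain M where M: "\<And>p q. p \<ge> M \<Longrightarrow> q \<ge> M \<Longrightarrow> dist (X p) (X q) < m * e"
        using metric_CauchyD[OF assms, of "m * e"] m by auto
      have "dist (z p) (z q) < e" if "p \<ge> M" "q \<ge> M" for p q
      proof -
        have "m * dist (z p) (z q) \<le> dist (X p) (X q)"
          using below[of "z p - z q"] by (simp add: dist_norm z f_diff)
        also have "\<dots> < m * e"
          using M that by simp
        finally show ?thesis
          using m by simp
      qed
      then show "\<exists>M. \<forall>p\<ge>M. \<forall>q\<ge>M. dist (z p) (z q) < e"
        by blast
    qed
    then obtain l where "z \<longlonglongrightarrow> l"
      by (meson Cauchy_convergent convergent_def)
    then have "(\<lambda>n. f (z n)) \<longlonglongrightarrow> f l"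
      unfolding f_def by (intro tendsto_intros)
    then show ?thesis
      by (auto simp: convergent_def z[abs_def])
  qed
qed

section \<open>Rows of indices and operators acting as scalars on them\<close>

text \<open>
  The coding of pairs is increasing in its second argument, as the axioms on subsequences and
  spreads demand, and every index lies in exactly one row.
\<close>

definition index_row :: "nat \<Rightarrow> nat \<Rightarrow> nat" where
  "index_row i k = prod_encode (i, k)"

lemma strict_mono_index_row: "strict_mono (index_row i)"
  by (simp add: strict_mono_Suc_iff index_row_def prod_encode_def)

lemma index_row_eq_iff [simp]: "index_row i k = index_row j l \<longleftrightarrow> i = j \<and> k = l"
  by (simp add: index_row_def inj_eq[OF inj_prod_encode])

lemma index_row_cases: obtains i k where "j = index_row i k"
proof
  show "j = index_row (fst (prod_decode j)) (snd (prod_decode j))"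
    by (simp add: index_row_def)
qed

lemma index_row_in_range_iff [simp]: "index_row i k \<in> range (index_row j) \<longleftrightarrow> i = j"
  by auto

context standard_banach_sequence_space
begin

lemma coord_add: "coord (x + y) j = coord x j + coord y j"
  and coord_scale: "coord (scaleE c x) j = scaleX c (coord x j)"
  using coord_linear[of j] by (simp_all add: Vector_Spaces.linear_iff)

lemma coord_scaleR: "coord (r *\<^sub>R x) j = r *\<^sub>R coord x j"
  using coord_scale[of "of_real r" x j] by (simp add: E.scale_of_real X.scale_of_real)

lemma coord_zero [simp]: "coord 0 j = 0"
  using coord_scaleR[of 0 0 j] by simp

lemma coord_diff: "coord (x - y) j = coord x j - coord y j"
  using coord_add[of "x - y" y j] by (simp add: algebra_simps)

lemma coord_eqI: "(\<And>j. coord x j = coord y j) \<Longrightarrow> x = y"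
  by (rule injD[OF coord_inj]) auto

lemma E_nonzero: "\<exists>x::'e. x \<noteq> 0"
proof -
  have "E.span {} \<noteq> UNIV"
    using E_infinite_dimensional unfolding infinite_dimensional_def by blast
  then show ?thesis
    by auto
qed

text \<open>
  Spreading appears as a relation between a sequence and its spread; linearity and continuity
  of the map \<open>S\<^sub>i\<close> are then never an issue.
\<close>

definition spreads_to :: "nat \<Rightarrow> 'e \<Rightarrow> 'e \<Rightarrow> bool" where
  "spreads_to i x y \<longleftrightarrow>
     (\<forall>k. coord y (index_row i k) = coord x k) \<and> (\<forall>j. j \<notin> range (index_row i) \<longrightarrow> coord y j = 0)"

lemma spreads_to_exists: obtains y where "spreads_to i x y"
  using spread[OF strict_mono_index_row, of i x] by (auto simp: spreads_to_def)

definition scalar_on_row :: "('e \<Rightarrow>\<^sub>L 'e) \<Rightarrow> nat \<Rightarrow> 'k \<Rightarrow> bool" where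
  "scalar_on_row T i a \<longleftrightarrow> (\<forall>x y. spreads_to i x y \<longrightarrow> blinfun_apply T y = scaleE a x)"

lemma surj_if_scalar_on_row:
  assumes "scalar_on_row T i a" and "a \<noteq> 0"
  shows "surj (blinfun_apply T)"
  unfolding surj_def
proof
  fix w
  obtain y where "spreads_to i (scaleE (inverse a) w) y"
    by (rule spreads_to_exists)
  then have "blinfun_apply T y = w"
    using assms by (simp add: scalar_on_row_def)
  then show "\<exists>y. w = blinfun_apply T y"
    by blast
qed

text \<open>
  In a convergent sequence of operators acting as scalars on a row, evaluation at one nonzero
  vector shows that the scalars form a Cauchy sequence.
\<close>

lemma closed_scalar_on_row: "closed {T. \<exists>a. scalar_on_row T i a}"
proof -
  obtain x0 :: 'e where x0: "x0 \<noteq> 0"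
    using E_nonzero by blast
  obtain y0 where y0: "spreads_to i x0 y0"
    by (rule spreads_to_exists)
  show ?thesis
    unfolding closed_sequential_limits
  proof (intro allI impI, elim conjE)
    fix T L assume "\<forall>n. T n \<in> {T. \<exists>a. scalar_on_row T i a}" and lim: "T \<longlonglongrightarrow> L"
    then obtain a where a: "\<And>n. scalar_on_row (T n) i (a n)"
      by (simp, metis)
    have lim_apply: "(\<lambda>n. scaleE (a n) x) \<longlonglongrightarrow> blinfun_apply L y" if "spreads_to i x y" for x y
    proof -
      have "(\<lambda>n. blinfun_apply (T n) y) \<longlonglongrightarrow> blinfun_apply L y"
        by (intro tendsto_intros lim)
      then show ?thesis
        using a that by (simp add: scalar_on_row_def)
    qed
    have "Cauchy (\<lambda>n. scaleE (a n) x0)"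
      using lim_apply[OF y0] by (rule LIMSEQ_imp_Cauchy)
    moreover have "dist (scaleE (a p) x0) (scaleE (a q) x0) = dist (a p) (a q) * norm x0" for p q
      by (simp add: dist_norm E.norm_scale flip: E.scale_left_diff_distrib)
    ultimately have *: "\<forall>e>0. \<exists>M. \<forall>p\<ge>M. \<forall>q\<ge>M. dist (a p) (a q) * norm x0 < e"
      by (simp add: Cauchy_def)
    have "Cauchy a"
    proof (rule metric_CauchyI)
      fix e :: real assume "e > 0"
      then have "e * norm x0 > 0"
        using x0 by simp
      then have "\<exists>M. \<forall>p\<ge>M. \<forall>q\<ge>M. dist (a p) (a q) * norm x0 < e * norm x0"
        using * by blast
      then show "\<exists>M. \<forall>p\<ge>M. \<forall>q\<ge>M. dist (a p) (a q) < e"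
        using x0 by simp
    qed
    then obtain l where l: "a \<longlonglongrightarrow> l"
      using scalars_complete by (auto simp: convergent_def)
    have "blinfun_apply L y = scaleE l x" if "spreads_to i x y" for x y
    proof -
      have "(\<lambda>n. norm (a n - l) * norm x) \<longlonglongrightarrow> 0"
        using l by (intro tendsto_mult_left_zero tendsto_norm_zero LIM_zero)
      then have "(\<lambda>n. norm (scaleE (a n) x - scaleE l x)) \<longlonglongrightarrow> 0"
        by (simp add: E.norm_scale flip: E.scale_left_diff_distrib)
      then have "(\<lambda>n. scaleE (a n) x - scaleE l x) \<longlonglongrightarrow> 0"
        by (rule tendsto_norm_zero_cancel)
      then have "(\<lambda>n. scaleE (a n) x) \<longlonglongrightarrow> scaleE l x"
        by (rule LIM_zero_cancel)
      then show ?thesis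
        using lim_apply[OF that] LIMSEQ_unique by blast
    qed
    then show "L \<in> {T. \<exists>a. scalar_on_row T i a}"
      by (auto simp: scalar_on_row_def)
  qed
qed

text \<open>
  A sequence with one nonzero entry lies in a single row, so it is the spread of an element
  of the space; finitely supported sequences follow by removing one entry at a time.
\<close>

lemma zero_if_zero_on_rows:
  assumes dense: "c00_dense coord"
    and T: "\<And>i. scalar_on_row T i 0"
  shows "T = 0"
proof -
  have c00_range: "\<exists>x. coord x = s" if "finite {j. s j \<noteq> 0}" for s
  proof -
    have "s \<in> range coord"
      using dense that by (auto simp: c00_dense_def c00_def)
    then show ?thesis
      by auto
  qed
  have finite_single: "finite {l. (if l = j then v else 0) \<noteq> 0}" for j :: nat and v :: 'x
    by (rule finite_subset[of _ "{j}"]) auto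
  have one_entry: "\<exists>z. (\<forall>l. coord z l = (if l = j then v else 0)) \<and> blinfun_apply T z = 0" for j v
  proof -
    obtain i k where j: "j = index_row i k"
      by (rule index_row_cases)
    obtain z where z: "coord z = (\<lambda>l. if l = j then v else 0)"
      using c00_range[OF finite_single] by blast
    obtain x where x: "coord x = (\<lambda>l. if l = k then v else 0)"
      using c00_range[OF finite_single] by blast
    have "spreads_to i x z"
      by (auto simp: spreads_to_def x z j)
    then have "blinfun_apply T z = 0"
      using T by (simp add: scalar_on_row_def)
    with z show ?thesis
      by (intro exI[of _ z]) simp
  qed
  have "blinfun_apply T z = 0" if "finite F" "{j. coord z j \<noteq> 0} \<subseteq> F" for F z
    using that
  proof (induction F arbitrary: z)
    case empty
    then have "z = 0"
      by (intro coord_eqI) auto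
    then show ?case
      by (simp add: blinfun.zero_right)
  next
    case (insert j F)
    obtain u where u: "\<And>l. coord u l = (if l = j then coord z j else 0)" "blinfun_apply T u = 0"
      using one_entry by blast
    have "{l. coord (z - u) l \<noteq> 0} \<subseteq> F"
      using insert.prems by (auto simp: coord_diff u split: if_splits)
    then have "blinfun_apply T (z - u) = 0"
      by (rule insert.IH)
    then show ?case
      using u(2) by (simp add: blinfun.diff_right)
  qed
  then have "{x. coord x \<in> c00} \<subseteq> {x. blinfun_apply T x = 0}"
    by (auto simp: c00_def)
  moreover have "closed {x. blinfun_apply T x = 0}"
    by (intro closed_Collect_eq continuous_intros)
  ultimately have "closure {x. coord x \<in> c00} \<subseteq> {x. blinfun_apply T x = 0}"
    by (rule closure_minimal)
  then show ?thesis
    using dense by (auto intro!: blinfun_eqI simp: c00_dense_def)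
qed

section \<open>Restriction operators and the subspace\<close>

lemma subsequence_operator_exists:
  assumes "strict_mono n"
  shows "\<exists>R \<in> operators scaleE. \<forall>x k. coord (blinfun_apply R x) k = coord x (n k)"
proof -
  have "\<forall>x. \<exists>y. (\<forall>k. coord y k = coord x (n k)) \<and> norm y \<le> norm x"
    using subsequence[OF assms] by blast
  then obtain f where f: "\<And>x k. coord (f x) k = coord x (n k)" "\<And>x. norm (f x) \<le> norm x"
    by metis
  have "bounded_linear f"
    by (rule bounded_linear_intro[where K = 1])
      (auto intro!: coord_eqI simp: f coord_add coord_scaleR)
  then have apply_f: "blinfun_apply (Blinfun f) = f"
    by (rule bounded_linear_Blinfun_apply)
  have "Vector_Spaces.linear scaleE scaleE f"
    by (auto intro!: coord_eqI
        simp: Vector_Spaces.linear_iff E.vector_space_axioms f coord_add coord_scale)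
  then have "Blinfun f \<in> operators scaleE"
    by (simp add: operators_def apply_f)
  then show ?thesis
    by (rule bexI[rotated]) (simp add: f(1) apply_f)
qed

definition restriction :: "nat \<Rightarrow> 'e \<Rightarrow>\<^sub>L 'e" where
  "restriction i =
     (SOME R. R \<in> operators scaleE \<and> (\<forall>x k. coord (blinfun_apply R x) k = coord x (index_row i k)))"

lemma restriction_operator: "restriction i \<in> operators scaleE"
  and coord_restriction: "coord (blinfun_apply (restriction i) x) k = coord x (index_row i k)"
  using someI_ex[OF subsequence_operator_exists[OF strict_mono_index_row, of i, unfolded Bex_def]]
  by (simp_all add: restriction_def)

lemma restriction_spread:
  assumes "spreads_to j x y"
  shows "blinfun_apply (restriction i) y = (if i = j then x else 0)"
  using assms by (intro coord_eqI) (auto simp: coord_restriction spreads_to_def)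

lemma restriction_scalar_on_row: "scalar_on_row (restriction i) j (if i = j then 1 else 0)"
  by (simp add: scalar_on_row_def restriction_spread)

definition scalar_on_rows :: "('e \<Rightarrow>\<^sub>L 'e) set" where
  "scalar_on_rows = {T \<in> operators scaleE. \<forall>i. \<exists>a. scalar_on_row T i a}"

sublocale B: vector_space "blinfun_scale scaleE"
  by (rule E.vector_space_blinfun_scale)

lemma subspace_scalar_on_rows: "B.subspace scalar_on_rows"
proof -
  have "scalar_on_row 0 i 0" for i
    by (simp add: scalar_on_row_def)
  moreover have "scalar_on_row (S + T) i (a + b)"
    if "scalar_on_row S i a" "scalar_on_row T i b" for S T i a b
    using that by (simp add: scalar_on_row_def blinfun.add_left E.scale_left_distrib)
  moreover have "scalar_on_row (blinfun_scale scaleE c T) i (c * a)"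
    if "scalar_on_row T i a" for c T i a
    using that by (simp add: scalar_on_row_def)
  ultimately show ?thesis
    using E.subspace_operators unfolding B.subspace_def scalar_on_rows_def
    by blast
qed

lemma closed_scalar_on_rows: "closedin (top_of_set (operators scaleE)) scalar_on_rows"
proof -
  have "scalar_on_rows = operators scaleE \<inter> (\<Inter>i. {T. \<exists>a. scalar_on_row T i a})"
    by (auto simp: scalar_on_rows_def)
  moreover have "closed (\<Inter>i. {T. \<exists>a. scalar_on_row T i a})"
    by (intro closed_INT ballI closed_scalar_on_row)
  ultimately show ?thesis
    by (auto simp: closedin_closed)
qed

text \<open>
  A nonzero sequence spread onto row \<open>i\<close> is mapped to zero by all restrictions but the
  \<open>i\<close>-th, hence by their span. This makes the restrictions distinct and independent.
\<close>

lemma infinite_dimensional_scalar_on_rows: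
  "infinite_dimensional (blinfun_scale scaleE) scalar_on_rows"
proof -
  obtain x :: 'e where x: "x \<noteq> 0"
    using E_nonzero by blast
  have not_in_span: "restriction i \<notin> B.span (restriction ` (- {i}))" for i
  proof
    assume i: "restriction i \<in> B.span (restriction ` (- {i}))"
    obtain y where y: "spreads_to i x y"
      by (rule spreads_to_exists)
    have "B.subspace {T. blinfun_apply T y = 0}"
      by (simp add: B.subspace_def blinfun.add_left)
    moreover have "restriction ` (- {i}) \<subseteq> {T. blinfun_apply T y = 0}"
      using restriction_spread[OF y] by auto
    ultimately have span: "B.span (restriction ` (- {i})) \<subseteq> {T. blinfun_apply T y = 0}"
      by (intro B.span_minimal)
    then show False
      using x subsetD[OF span i] restriction_spread[OF y, of i] by simp
  qed
  have inj: "inj restriction"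
  proof (rule injI, rule ccontr)
    fix i j assume "restriction i = restriction j" "i \<noteq> j"
    then have "restriction i \<in> restriction ` (- {i})"
      by (metis ComplI image_eqI singletonD)
    then have "restriction i \<in> B.span (restriction ` (- {i}))"
      by (rule B.span_base)
    then show False
      using not_in_span[of i] by contradiction
  qed
  have "B.independent (range restriction)"
  proof
    assume "B.dependent (range restriction)"
    then obtain i where "restriction i \<in> B.span (range restriction - {restriction i})"
      unfolding B.dependent_def by blast
    moreover have "B.span (range restriction - {restriction i}) \<subseteq> B.span (restriction ` (- {i}))"
      by (rule B.span_mono) auto
    ultimately have "restriction i \<in> B.span (restriction ` (- {i}))"
      by (rule subsetD[rotated])
    then show False
      using not_in_span[of i] by contradiction
  qed
  moreover have "range restriction \<subseteq> scalar_on_rows"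
    using restriction_operator restriction_scalar_on_row by (auto simp: scalar_on_rows_def)
  ultimately have "finite (range restriction)" if "finite A" "B.span A = scalar_on_rows" for A
    using B.independent_span_bound[OF that(1)] that(2) by simp
  then show ?thesis
    using range_inj_infinite[OF inj] unfolding infinite_dimensional_def by blast
qed

end

theorem theorem1p2:
  fixes scaleX :: "'k::real_or_complex \<Rightarrow> 'x::banach \<Rightarrow> 'x"
    and scaleE :: "'k \<Rightarrow> 'e::banach \<Rightarrow> 'e"
    and coord :: "'e \<Rightarrow> nat \<Rightarrow> 'x"
  assumes "standard_banach_sequence_space scaleX scaleE coord"
    and "c00_dense coord"
  shows "spaceable_in (blinfun_scale scaleE) (operators scaleE)
           {T \<in> operators scaleE. surj (blinfun_apply T)}"
proof -
  interpret standard_banach_sequence_space scaleX scaleE coord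
    by fact
  have "scalar_on_rows \<subseteq> {T \<in> operators scaleE. surj (blinfun_apply T)} \<union> {0}"
  proof
    fix T assume T: "T \<in> scalar_on_rows"
    then have "surj (blinfun_apply T)" if "T \<noteq> 0"
      using that zero_if_zero_on_rows[OF assms(2)] surj_if_scalar_on_row
      unfolding scalar_on_rows_def by blast
    then show "T \<in> {T \<in> operators scaleE. surj (blinfun_apply T)} \<union> {0}"
      using T by (auto simp: scalar_on_rows_def)
  qed
  then show ?thesis
    unfolding spaceable_in_def
    using subspace_scalar_on_rows closed_scalar_on_rows infinite_dimensional_scalar_on_rows
    by blast
qed

end
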